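(* Let $G$ be a weighted graph with $n \ge 5$ nodes and edge weights $g_{\{i,j\}} \in \mathbb{R}$ ($i \ne j$). Suppose that $$g_{\{i,j\}} + g_{\{j,k\}} \ne g_{\{m,p\}} + g_{\{q,r\}}$$ for every pairwise distinct $i,j,k \in \{1,\ldots,n\}$ and every pairwise distinct $m,p,q,r \in \{1,\ldots,n\}$. Then $G$ is reconstructible from $\mathcal{D}_g(G)$ and $\mathcal{D}_\alpha(G)$; that is, every weighted graph $G'$ with $n$ nodes and real edge weights satisfying $\mathcal{D}_g(G') = \mathcal{D}_g(G)$ and $\mathcal{D}_\alpha(G') = \mathcal{D}_\alpha(G)$ is isomorphic to $G$.
   Context: Here a weighted graph $G$ with $n$ nodes is a complete graph on $\{1,\ldots,n\}$ with a weight $g_{\{i,j\}} \in \mathbb{R}$ assigned to each two-element subset $\{i,j\}$ (no node weights). Two such graphs with weights $g_{\{i,j\}}$ and $g'_{\{i,j\}}$ are isomorphic if there is a permutation $\pi \in S_n$ with $g'_{\{i,j\}} = g_{\{\pi(i),\pi(j)\}}$ for all $i \ne j$. A distribution means a multiset, i.e. a set with a positive integer multiplicity for each element. $\mathcal{D}_g(G)$ is the multiset of all $g_{\{i,j\}}$, taken over the two-element subsets $\{i,j\} \subseteq \{1,\ldots,n\}$. For pairwise distinct $i,j,k$ put $\alpha_{i,j,k} = g_{\{i,j\}} + g_{\{j,k\}}$; $\mathcal{D}_\alpha(G)$ is the multiset of all $\alpha_{i,j,k}$, taken over all pairwise distinct $i,j,k \in \{1,\ldots,n\}$. *)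

theory Defs
  imports Complex_Main "HOL-Library.Multiset" "HOL-Combinatorics.Permutations"
begin

text \<open>
  A weighted graph on the nodes \<open>{1..n}\<close> is given by \<open>n\<close> together with a function
  \<open>g :: nat set \<Rightarrow> real\<close>; the weight of the edge between \<open>i\<close> and \<open>j\<close> is \<open>g {i, j}\<close>.
  Only the values of \<open>g\<close> on \<open>node_pairs n\<close> carry meaning: every notion below depends
  on those values alone.
\<close>

type_synonym weights = "nat set \<Rightarrow> real"

definition node_pairs :: "nat \<Rightarrow> nat set set" where
  "node_pairs n = {e. e \<subseteq> {1..n} \<and> card e = 2}"

definition node_triples :: "nat \<Rightarrow> (nat \<times> nat \<times> nat) set" where
  "node_triples n = {(i, j, k). {i, j, k} \<subseteq> {1..n} \<and> distinct [i, j, k]}"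

definition alpha :: "weights \<Rightarrow> nat \<Rightarrow> nat \<Rightarrow> nat \<Rightarrow> real" where
  "alpha g i j k = g {i, j} + g {j, k}"

definition dist_g :: "nat \<Rightarrow> weights \<Rightarrow> real multiset" where
  "dist_g n g = image_mset g (mset_set (node_pairs n))"

text \<open>
  The triples are ordered, so \<open>(i, j, k)\<close> and \<open>(k, j, i)\<close>, which have the same value,
  both contribute.
\<close>

definition dist_alpha :: "nat \<Rightarrow> weights \<Rightarrow> real multiset" where
  "dist_alpha n g = image_mset (\<lambda>(i, j, k). alpha g i j k) (mset_set (node_triples n))"

definition isomorphic_graphs :: "nat \<Rightarrow> weights \<Rightarrow> weights \<Rightarrow> bool" where
  "isomorphic_graphs n g g' \<longleftrightarrow>
     (\<exists>\<pi>. \<pi> permutes {1..n} \<and>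
       (\<forall>i\<in>{1..n}. \<forall>j\<in>{1..n}. i \<noteq> j \<longrightarrow> g' {i, j} = g {\<pi> i, \<pi> j}))"

text \<open>Finiteness matters because \<open>mset_set\<close> of an infinite set is empty.\<close>

lemma finite_node_pairs: "finite (node_pairs n)"
  by (rule finite_subset[of _ "Pow {1..n}"]) (auto simp: node_pairs_def)

lemma finite_node_triples: "finite (node_triples n)"
  by (rule finite_subset[of _ "{1..n} \<times> {1..n} \<times> {1..n}"]) (auto simp: node_triples_def)

end

theory Submission
  imports Defs
begin

text \<open>
  The hypothesis says that the weight sum of two distinct edges reveals whether they share a
  node. It forces all edge weights to be distinct: given two edges of equal weight, some third
  edge meets exactly one of them, and its sums with the two would coincide
  (\<open>weights_inj_on\<close>).

  Hence equality of the edge weight distributions provides a unique permutation \<open>\<phi>\<close> of the edges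
  with \<open>g' = g \<circ> \<phi>\<close>. If two edges share a node, the sum of their weights in \<open>g'\<close> is, by equality
  of the other distribution, the sum of two adjacent weights of \<open>g\<close>; so their images under \<open>\<phi>\<close>
  cannot be disjoint. Thus \<open>\<phi>\<close> is an automorphism of the line graph of the complete graph.

  For at least five nodes, such an automorphism comes from a permutation of the nodes, which is
  Whitney's theorem for complete graphs (\<open>intersection_preserving_induced_by_permutation\<close>):
  the edges at a node form an intersecting family with at least four members, which \<open>\<phi>\<close> maps to
  another one, and every such family has a common node
  (\<open>intersecting_pairs_common_element\<close>).
\<close>

abbreviation pairs_of :: "'a set \<Rightarrow> 'a set set" where
  "pairs_of V \<equiv> {e. e \<subseteq> V \<and> card e = 2}"

abbreviation star :: "'a set \<Rightarrow> 'a \<Rightarrow> 'a set set" where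
  "star V v \<equiv> {e \<in> pairs_of V. v \<in> e}"

lemma pair_eqI:
  assumes "card e = 2" "a \<in> e" "b \<in> e" "a \<noteq> b"
  shows "e = {a, b}"
proof -
  have "finite e"
    using assms(1) by (intro card_ge_0_finite) simp
  then show ?thesis
    using assms by (intro card_subset_eq[symmetric]) auto
qed

lemma pair_otherE:
  assumes "card e = 2" "v \<in> e"
  obtains a where "e = {v, a}" "v \<noteq> a"
proof -
  obtain x y where "e = {x, y}" "x \<noteq> y"
    using assms(1) by (auto simp: card_2_iff)
  with assms(2) that show thesis
    by (cases "v = x") auto
qed

text \<open>
  An intersecting family of pairs without a common element contains
  \<open>{v, a}\<close>, \<open>{v, b}\<close> and \<open>{a, b}\<close> for some \<open>v\<close>, \<open>a\<close>, \<open>b\<close>, and no fourth pair meets all three of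
  these. The bound is sharp because of the triangle.
\<close>

lemma intersecting_pairs_common_element:
  assumes "card F \<ge> 4"
    and pairs: "\<And>e. e \<in> F \<Longrightarrow> card e = 2"
    and meet: "\<And>e f. e \<in> F \<Longrightarrow> f \<in> F \<Longrightarrow> e \<inter> f \<noteq> {}"
  obtains v where "\<And>e. e \<in> F \<Longrightarrow> v \<in> e"
proof -
  have "\<not> card F \<le> 1"
    using assms(1) by simp
  moreover have "finite F"
    using assms(1) by (intro card_ge_0_finite) simp
  ultimately obtain e f where ef: "e \<in> F" "f \<in> F" "e \<noteq> f"
    by (auto simp: card_le_Suc0_iff_eq)
  from meet[OF ef(1,2)] obtain v where v: "v \<in> e" "v \<in> f"
    by blast
  obtain a where a: "e = {v, a}" "v \<noteq> a"
    using pairs[OF ef(1)] v(1) by (rule pair_otherE)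
  obtain b where b: "f = {v, b}" "v \<noteq> b"
    using pairs[OF ef(2)] v(2) by (rule pair_otherE)
  have "a \<noteq> b"
    using a b ef by auto
  have "v \<in> h" if h: "h \<in> F" for h
  proof (rule ccontr)
    assume "v \<notin> h"
    then have ab: "a \<in> h" "b \<in> h"
      using meet[OF h ef(1)] meet[OF h ef(2)] a b by auto
    have h_eq: "h = {a, b}"
      using pairs[OF h] ab \<open>a \<noteq> b\<close> by (rule pair_eqI)
    have "k \<in> {e, f, h}" if k: "k \<in> F" for k
    proof -
      have "k \<inter> {v, a} \<noteq> {}" "k \<inter> {v, b} \<noteq> {}" "k \<inter> {a, b} \<noteq> {}"
        using meet[OF k ef(1)] meet[OF k ef(2)] meet[OF k h] a(1) b(1) h_eq by simp_all
      then consider "v \<in> k" "a \<in> k" | "v \<in> k" "b \<in> k" | "a \<in> k" "b \<in> k"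
        by blast
      then show ?thesis
      proof cases
        case 1
        then show ?thesis
          using pair_eqI[OF pairs[OF k], of v a] a by simp
      next
        case 2
        then show ?thesis
          using pair_eqI[OF pairs[OF k], of v b] b by simp
      next
        case 3
        then show ?thesis
          using pair_eqI[OF pairs[OF k], of a b] h_eq \<open>a \<noteq> b\<close> by simp
      qed
    qed
    then have "F \<subseteq> {e, f, h}"
      by blast
    then have "card F \<le> card {e, f, h}"
      by (intro card_mono) auto
    also have "\<dots> \<le> 3"
      by (simp add: card_insert_if)
    finally show False
      using assms(1) by simp
  qed
  then show thesis
    by (rule that)
qed

lemma card_star:
  assumes "finite V" "v \<in> V"
  shows "card (star V v) = card V - 1"
proof -
  have "star V v = (\<lambda>w. {v, w}) ` (V - {v})"
    using assms(2) by (auto elim!: pair_otherE[of _ v])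
  moreover have "inj_on (\<lambda>w. {v, w}) (V - {v})"
    by (auto simp: inj_on_def doubleton_eq_iff)
  ultimately show ?thesis
    using assms by (simp add: card_image)
qed

text \<open>
  This is Whitney's theorem on line graphs for complete graphs. Each star has at least four
  members and is therefore mapped into, and for reasons of cardinality onto, another star; sending
  the centre of the one to the centre of the other gives the permutation of the nodes. On four
  nodes the claim fails: sending two opposite edges to each other and fixing the other
  four edges preserves intersections.
\<close>

lemma intersection_preserving_induced_by_permutation:
  assumes V: "finite V" "card V \<ge> 5"
    and inj: "inj_on \<phi> (pairs_of V)"
    and maps: "\<And>e. e \<in> pairs_of V \<Longrightarrow> \<phi> e \<in> pairs_of V"
    and meet: "\<And>e f. e \<in> pairs_of V \<Longrightarrow> f \<in> pairs_of V \<Longrightarrow> e \<inter> f \<noteq> {} \<Longrightarrow> \<phi> e \<inter> \<phi> f \<noteq> {}"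
  obtains \<pi> where "\<pi> permutes V" "\<And>e. e \<in> pairs_of V \<Longrightarrow> \<phi> e = \<pi> ` e"
proof -
  have inj_star: "inj_on \<phi> (star V v)" for v
    using inj by (rule inj_on_subset) auto
  have fin: "finite (star V v)" for v
    using V(1) by (auto intro: finite_subset[of _ "Pow V"])
  have "\<exists>w\<in>V. \<phi> ` star V v = star V w" if v: "v \<in> V" for v
  proof -
    have card_image_star: "card (\<phi> ` star V v) = card V - 1"
      using card_image[OF inj_star] card_star[OF V(1) v] by simp
    obtain w where w: "\<And>e. e \<in> \<phi> ` star V v \<Longrightarrow> w \<in> e"
    proof (rule intersecting_pairs_common_element[of "\<phi> ` star V v"])
      show "card (\<phi> ` star V v) \<ge> 4"
        using card_image_star V(2) by simp
      show "card e = 2" if "e \<in> \<phi> ` star V v" for e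
        using that maps by auto
      show "e \<inter> f \<noteq> {}" if ef: "e \<in> \<phi> ` star V v" "f \<in> \<phi> ` star V v" for e f
      proof -
        from ef obtain e' f' where "e' \<in> star V v" "f' \<in> star V v" "e = \<phi> e'" "f = \<phi> f'"
          by blast
        then show ?thesis
          using meet[of e' f'] by blast
      qed
    qed blast
    have sub: "\<phi> ` star V v \<subseteq> star V w"
      using w maps by blast
    have "card (\<phi> ` star V v) > 0"
      using card_image_star V(2) by linarith
    then have "\<phi> ` star V v \<noteq> {}"
      unfolding card_gt_0_iff by (rule conjunct1)
    then have "w \<in> V"
      using sub by blast
    moreover have "\<phi> ` star V v = star V w"
      using sub card_image_star card_star[OF V(1) \<open>w \<in> V\<close>] by (intro card_subset_eq fin) auto
    ultimately show ?thesis
      by blast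
  qed
  then have "\<forall>v\<in>V. \<exists>w. w \<in> V \<and> \<phi> ` star V v = star V w"
    by blast
  from bchoice[OF this] obtain p
    where p: "\<forall>v\<in>V. p v \<in> V \<and> \<phi> ` star V v = star V (p v)" ..
  have p_in: "p v \<in> V" and p_star: "\<phi> ` star V v = star V (p v)" if "v \<in> V" for v
    using p that by simp_all
  have p_inj: "inj_on p V"
  proof (rule inj_onI, rule ccontr)
    fix u v assume uv: "u \<in> V" "v \<in> V" "p u = p v" "u \<noteq> v"
    have "\<phi> ` star V u = \<phi> ` star V v"
      unfolding p_star[OF uv(1)] p_star[OF uv(2)] uv(3) ..
    then have same: "star V u = star V v"
      by (subst (asm) inj_on_image_eq_iff[OF inj]) auto
    \<comment> \<open>Two nodes have the same star only if they are the only nodes.\<close>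
    have "\<not> V \<subseteq> {u, v}"
      using V card_mono[of "{u, v}" V] uv by auto
    then obtain w where w: "w \<in> V" "w \<noteq> u" "w \<noteq> v"
      by blast
    then have "{u, w} \<in> star V u"
      using uv(1) by simp
    then have "v \<in> {u, w}"
      unfolding same by simp
    then show False
      using uv(4) w by simp
  qed
  define \<pi> where "\<pi> = (\<lambda>v. if v \<in> V then p v else v)"
  have "inj_on \<pi> V" "\<pi> ` V \<subseteq> V"
    using p_inj p_in by (auto simp: \<pi>_def inj_on_def)
  then have "bij_betw \<pi> V V"
    using V(1) by (simp add: bij_betw_def endo_inj_surj)
  then have "\<pi> permutes V"
    by (rule bij_imp_permutes) (simp add: \<pi>_def)
  moreover have "\<phi> e = \<pi> ` e" if e: "e \<in> pairs_of V" for e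
  proof -
    have e': "e \<subseteq> V" "card e = 2"
      using e by simp_all
    then obtain u v where uv: "e = {u, v}" "u \<noteq> v"
      unfolding card_2_iff by blast
    have "u \<in> e" "v \<in> e"
      unfolding uv(1) by simp_all
    then have uv_in: "u \<in> V" "v \<in> V" and "e \<in> star V u" "e \<in> star V v"
      using e' by blast+
    then have "\<phi> e \<in> star V (p u)" "\<phi> e \<in> star V (p v)"
      unfolding p_star[OF uv_in(1), symmetric] p_star[OF uv_in(2), symmetric]
      by (simp_all only: imageI)
    moreover have "p u \<noteq> p v"
      using p_inj uv(2) uv_in by (simp add: inj_on_eq_iff)
    ultimately have "\<phi> e = {p u, p v}"
      by (intro pair_eqI) simp_all
    then show ?thesis
      using uv uv_in by (simp add: \<pi>_def)
  qed
  ultimately show thesis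
    by (rule that)
qed

lemma weights_inj_on:
  assumes n: "n \<ge> 5"
    and separated: "\<And>i j k m p q r.
           {i, j, k} \<subseteq> {1..n} \<Longrightarrow> distinct [i, j, k] \<Longrightarrow>
           {m, p, q, r} \<subseteq> {1..n} \<Longrightarrow> distinct [m, p, q, r] \<Longrightarrow>
           g {i, j} + g {j, k} \<noteq> g {m, p} + g {q, r}"
  shows "inj_on g (node_pairs n)"
proof (rule inj_onI, rule ccontr)
  fix e f assume ef: "e \<in> node_pairs n" "f \<in> node_pairs n" "g e = g f" "e \<noteq> f"
  obtain a b where e: "e = {a, b}" "a \<noteq> b"
    using ef(1) by (auto simp: node_pairs_def card_2_iff)
  have "card e = 2" "card f = 2" "finite e"
    using ef(1,2) e(1) by (auto simp: node_pairs_def)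
  \<comment> \<open>The edge \<open>{c, x}\<close> that meets only one of the two joins an end \<open>c\<close> of \<open>f\<close> outside \<open>e\<close> to a node \<open>x\<close> outside both.\<close>
  then have "\<not> f \<subseteq> e"
    using card_subset_eq[of e f] ef(4) by auto
  then obtain c where c: "c \<in> f" "c \<notin> e"
    by blast
  then obtain d where d: "f = {c, d}" "c \<noteq> d"
    using \<open>card f = 2\<close> by (auto elim: pair_otherE)
  have f: "f = {d, c}" "d \<noteq> c"
    using d by auto
  have "card {a, b, c, d} \<le> 4"
    by (simp add: card_insert_if)
  then have "\<not> {1..n} \<subseteq> {a, b, c, d}"
    using n card_mono[of "{a, b, c, d}" "{1..n}"] by auto
  then obtain x where x: "x \<in> {1..n}" "x \<notin> {a, b, c, d}"
    by blast
  have "g {d, c} + g {c, x} \<noteq> g {a, b} + g {c, x}"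
    using ef(1,2) e c f x by (intro separated) (auto simp: node_pairs_def)
  then show False
    using ef(3) e f by simp
qed

theorem theorem3p2:
  fixes n :: nat and g :: "nat set \<Rightarrow> real"
  assumes "n \<ge> 5"
    and "\<And>i j k m p q r.
           {i, j, k} \<subseteq> {1..n} \<Longrightarrow> distinct [i, j, k] \<Longrightarrow>
           {m, p, q, r} \<subseteq> {1..n} \<Longrightarrow> distinct [m, p, q, r] \<Longrightarrow>
           g {i, j} + g {j, k} \<noteq> g {m, p} + g {q, r}"
  shows "\<forall>g' :: nat set \<Rightarrow> real.
           dist_g n g' = dist_g n g \<and> dist_alpha n g' = dist_alpha n g \<longrightarrow>
           isomorphic_graphs n g g'"
proof (intro allI impI, elim conjE)
  fix g' :: "nat set \<Rightarrow> real"
  assume dg: "dist_g n g' = dist_g n g" and da: "dist_alpha n g' = dist_alpha n g"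
  let ?E = "node_pairs n"
  have g_inj: "inj_on g ?E"
    using assms by (rule weights_inj_on)
  have img: "g' ` ?E = g ` ?E"
    using arg_cong[OF dg, of set_mset] by (simp add: dist_g_def finite_node_pairs)
  then have g'_inj: "inj_on g' ?E"
    by (metis card_image eq_card_imp_inj_on finite_node_pairs g_inj)
  define \<phi> where "\<phi> = inv_into ?E g \<circ> g'"
  have \<phi>_in: "\<phi> e \<in> ?E" and g_\<phi>: "g (\<phi> e) = g' e" if "e \<in> ?E" for e
  proof -
    have "g' e \<in> g ` ?E"
      using that img by blast
    then show "\<phi> e \<in> ?E" "g (\<phi> e) = g' e"
      by (simp_all add: \<phi>_def inv_into_into f_inv_into_f)
  qed
  have \<phi>_inj: "inj_on \<phi> ?E"
    by (metis g_\<phi> g'_inj inj_on_def)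
  have \<phi>_meet: "\<phi> e \<inter> \<phi> f \<noteq> {}" if ef: "e \<in> ?E" "f \<in> ?E" "e \<inter> f \<noteq> {}" for e f
  proof (cases "e = f")
    case True
    then show ?thesis
      using \<phi>_in[OF ef(1)] by (auto simp: node_pairs_def)
  next
    case False
    obtain j where j: "j \<in> e" "j \<in> f"
      using ef(3) by blast
    have "card e = 2" "card f = 2"
      using ef by (auto simp: node_pairs_def)
    then obtain i k where i: "e = {i, j}" "i \<noteq> j" and k: "f = {j, k}" "k \<noteq> j"
      using j by (metis pair_otherE insert_commute)
    have "(i, j, k) \<in> node_triples n"
      using ef i k False by (auto simp: node_triples_def node_pairs_def)
    then have "g' e + g' f \<in># dist_alpha n g'"
      using i k by (force simp: dist_alpha_def alpha_def finite_node_triples)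
    then obtain a b c where abc: "(a, b, c) \<in> node_triples n"
      and sum: "g' e + g' f = g {a, b} + g {b, c}"
      unfolding da by (auto simp: dist_alpha_def alpha_def finite_node_triples)
    show ?thesis
    proof
      assume disj: "\<phi> e \<inter> \<phi> f = {}"
      obtain m p where mp: "\<phi> e = {m, p}" "m \<noteq> p"
        using \<phi>_in[OF ef(1)] by (auto simp: node_pairs_def card_2_iff)
      obtain q r where qr: "\<phi> f = {q, r}" "q \<noteq> r"
        using \<phi>_in[OF ef(2)] by (auto simp: node_pairs_def card_2_iff)
      have "{m, p} \<subseteq> {1..n}" "{q, r} \<subseteq> {1..n}"
        using \<phi>_in[OF ef(1)] \<phi>_in[OF ef(2)] unfolding mp(1) qr(1) by (simp_all add: node_pairs_def)
      moreover have "{m, p} \<inter> {q, r} = {}"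
        using disj unfolding mp(1) qr(1) .
      ultimately have "{m, p, q, r} \<subseteq> {1..n}" "distinct [m, p, q, r]"
        using mp(2) qr(2) by simp_all
      moreover have "{a, b, c} \<subseteq> {1..n}" "distinct [a, b, c]"
        using abc by (simp_all add: node_triples_def)
      ultimately have "g {a, b} + g {b, c} \<noteq> g {m, p} + g {q, r}"
        by (intro assms(2))
      then show False
        using sum g_\<phi>[OF ef(1)] g_\<phi>[OF ef(2)] mp qr by simp
    qed
  qed
  obtain \<pi> where \<pi>: "\<pi> permutes {1..n}" "\<And>e. e \<in> ?E \<Longrightarrow> \<phi> e = \<pi> ` e"
    using intersection_preserving_induced_by_permutation[of "{1..n}" \<phi>]
      assms(1) \<phi>_inj \<phi>_in \<phi>_meet
    unfolding node_pairs_def by auto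
  have "g' {i, j} = g {\<pi> i, \<pi> j}" if "i \<in> {1..n}" "j \<in> {1..n}" "i \<noteq> j" for i j
  proof -
    have "{i, j} \<in> ?E"
      using that by (simp add: node_pairs_def)
    then show ?thesis
      using g_\<phi> \<pi>(2) by fastforce
  qed
  with \<pi>(1) show "isomorphic_graphs n g g'"
    unfolding isomorphic_graphs_def by blast
qed

end
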